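(* Let $\widehat E=E+\varepsilon E_0$ and $\widehat F=F+\varepsilon F_0$ be dual matrices in $\mathbb{D}^{m\times n}$ whose dual Moore-Penrose generalized inverses (DMPGIs) exist. If $\widehat E\overset{{\rm DM}\text{-}\ast}{\leq}\widehat F$ (Dual-minus star partial order), then $\widehat E\overset{\rm D}{\leq}\widehat F$ (Dual-minus partial order).
   Context: $\varepsilon$ is the dual unit: $\varepsilon\neq 0$, $\varepsilon^2=0$, commuting with reals. $\mathbb{D}^{m\times n}$ is the set of $m\times n$ dual matrices $\widehat E=E+\varepsilon E_0$ with $E,E_0\in\mathbb{R}^{m\times n}$, with the obvious addition, multiplication and transpose $\widehat E^{T}=E^T+\varepsilon E_0^T$. The DMPGI of $\widehat E\in\mathbb{D}^{m\times n}$ is the unique $\widehat X\in\mathbb{D}^{n\times m}$, if it exists, with $\widehat E\widehat X\widehat E=\widehat E$, $\widehat X\widehat E\widehat X=\widehat X$, $(\widehat E\widehat X)^T=\widehat E\widehat X$, $(\widehat X\widehat E)^T=\widehat X\widehat E$. Minus partial order on real matrices of the same size: $E\leq F$ means $\mathrm{rk}(F-E)=\mathrm{rk}(F)-\mathrm{rk}(E)$. Star partial order: $E\overset{\ast}{\leq}F$ means $E^{T}E=E^{T}F$ and $EE^{T}=FE^{T}$. For $\widehat E,\widehat F\in\mathbb{D}^{m\times n}$ whose DMPGIs exist: (i) Dual-minus partial order: $\widehat E\overset{\rm D}{\leq}\widehat F$ means that $E\leq F$ and the DMPGI of $\widehat F-\widehat E$ exists. (ii) Dual-minus star partial order: $\widehat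 E\overset{{\rm DM}\text{-}\ast}{\leq}\widehat F$ means that $E\overset{\ast}{\leq}F$ and the DMPGI of $\widehat F-\widehat E$ exists. *)

theory Defs
  imports "HOL-Analysis.Analysis"
begin

datatype dual_num = Dual (std_part: real) (dual_part: real)

instantiation dual_num :: comm_ring_1
begin

definition "0 = Dual 0 0"
definition "1 = Dual 1 0"
definition "x + y = Dual (std_part x + std_part y) (dual_part x + dual_part y)"
definition "- x = Dual (- std_part x) (- dual_part x)"
definition "x - y = Dual (std_part x - std_part y) (dual_part x - dual_part y)"
definition "x * y = Dual (std_part x * std_part y)
                         (std_part x * dual_part y + dual_part x * std_part y)"

instance
  by standard
    (simp_all add: zero_dual_num_def one_dual_num_def plus_dual_num_def uminus_dual_num_def
      minus_dual_num_def times_dual_num_def algebra_simps)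

end

definition dual_eps :: dual_num where
  "dual_eps = Dual 0 1"

lemma dual_eps_nonzero: "dual_eps \<noteq> 0"
  by (simp add: dual_eps_def zero_dual_num_def)

lemma dual_eps_square: "dual_eps ^ 2 = 0"
  by (simp add: dual_eps_def zero_dual_num_def times_dual_num_def power2_eq_square)

lemma Dual_eq: "Dual a b = Dual a 0 + dual_eps * Dual b 0"
  by (simp add: dual_eps_def plus_dual_num_def times_dual_num_def)

text \<open>
  Dual matrices with m rows and n columns are the library matrices over the dual numbers,
  so that addition, multiplication and transposition are the library ones. The matrix
  \<open>E + \<epsilon> E0\<close> is \<open>dual_matrix E E0\<close>; every dual matrix has this form.
\<close>

definition dual_matrix :: "real^'n^'m \<Rightarrow> real^'n^'m \<Rightarrow> dual_num^'n^'m" where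
  "dual_matrix E E0 = (\<chi> i j. Dual (E $ i $ j) (E0 $ i $ j))"

definition std_matrix :: "dual_num^'n^'m \<Rightarrow> real^'n^'m" where
  "std_matrix A = (\<chi> i j. std_part (A $ i $ j))"

definition inf_matrix :: "dual_num^'n^'m \<Rightarrow> real^'n^'m" where
  "inf_matrix A = (\<chi> i j. dual_part (A $ i $ j))"

lemma dual_matrix_parts: "dual_matrix (std_matrix A) (inf_matrix A) = A"
  by (simp add: dual_matrix_def std_matrix_def inf_matrix_def vec_eq_iff)

lemma std_matrix_dual_matrix [simp]: "std_matrix (dual_matrix E E0) = E"
  by (simp add: dual_matrix_def std_matrix_def vec_eq_iff)

lemma inf_matrix_dual_matrix [simp]: "inf_matrix (dual_matrix E E0) = E0"
  by (simp add: dual_matrix_def inf_matrix_def vec_eq_iff)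

lemma dual_matrix_add:
  "dual_matrix E E0 + dual_matrix F F0 = dual_matrix (E + F) (E0 + F0)"
  by (simp add: dual_matrix_def vec_eq_iff plus_dual_num_def)

lemma dual_matrix_diff:
  "dual_matrix E E0 - dual_matrix F F0 = dual_matrix (E - F) (E0 - F0)"
  by (simp add: dual_matrix_def vec_eq_iff minus_dual_num_def)

lemma std_part_sum: "std_part (sum f A) = (\<Sum>x\<in>A. std_part (f x))"
  by (induction A rule: infinite_finite_induct) (simp_all add: zero_dual_num_def plus_dual_num_def)

lemma dual_part_sum: "dual_part (sum f A) = (\<Sum>x\<in>A. dual_part (f x))"
  by (induction A rule: infinite_finite_induct) (simp_all add: zero_dual_num_def plus_dual_num_def)

lemma dual_matrix_mult:
  "dual_matrix E E0 ** dual_matrix F F0 = dual_matrix (E ** F) (E ** F0 + E0 ** F)"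
  by (simp add: dual_matrix_def vec_eq_iff matrix_matrix_mult_def dual_num.expand
      std_part_sum dual_part_sum times_dual_num_def sum.distrib)

lemma transpose_dual_matrix:
  "transpose (dual_matrix E E0) = dual_matrix (transpose E) (transpose E0)"
  by (simp add: dual_matrix_def transpose_def vec_eq_iff)

definition is_DMPGI :: "dual_num^'n^'m \<Rightarrow> dual_num^'m^'n \<Rightarrow> bool" where
  "is_DMPGI A X \<longleftrightarrow>
     A ** X ** A = A \<and> X ** A ** X = X \<and>
     transpose (A ** X) = A ** X \<and> transpose (X ** A) = X ** A"

lemma is_DMPGI_unique:
  assumes X: "is_DMPGI A X" and Y: "is_DMPGI A Y"
  shows "X = Y"
proof -
  have t: "transpose (P ** Q) = transpose Q ** transpose P"
    for P :: "dual_num^'c^'d" and Q :: "dual_num^'e^'c"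
    by (rule matrix_transpose_mul)
  have "A ** X = (A ** Y) ** (A ** X)"
    using Y by (simp add: is_DMPGI_def matrix_mul_assoc)
  also have "\<dots> = transpose ((A ** X) ** (A ** Y))"
    using X Y by (simp add: is_DMPGI_def t[of "A ** X" "A ** Y"])
  also have "\<dots> = A ** Y"
    using X Y by (simp add: is_DMPGI_def matrix_mul_assoc)
  finally have AX: "A ** X = A ** Y" .
  have "X ** A = (X ** A) ** (Y ** A)"
    using Y by (simp add: is_DMPGI_def flip: matrix_mul_assoc)
  also have "\<dots> = transpose ((Y ** A) ** (X ** A))"
    using X Y by (simp add: is_DMPGI_def t[of "Y ** A" "X ** A"])
  also have "\<dots> = Y ** A"
    using X Y by (simp add: is_DMPGI_def flip: matrix_mul_assoc)
  finally have XA: "X ** A = Y ** A" .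
  have "X = X ** A ** X"
    using X by (simp add: is_DMPGI_def)
  also have "\<dots> = Y ** (A ** X)"
    by (simp add: XA matrix_mul_assoc)
  also have "\<dots> = Y"
    using Y by (simp add: AX is_DMPGI_def matrix_mul_assoc)
  finally show ?thesis .
qed

definition DMPGI_exists :: "dual_num^'n^'m \<Rightarrow> bool" where
  "DMPGI_exists A \<longleftrightarrow> (\<exists>X. is_DMPGI A X)"

text \<open>The ranks are compared in the integers, since subtraction of naturals truncates.\<close>

definition minus_le :: "real^'n^'m \<Rightarrow> real^'n^'m \<Rightarrow> bool" where
  "minus_le E F \<longleftrightarrow> int (rank (F - E)) = int (rank F) - int (rank E)"

definition star_le :: "real^'n^'m \<Rightarrow> real^'n^'m \<Rightarrow> bool" where
  "star_le E F \<longleftrightarrow>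
     transpose E ** E = transpose E ** F \<and> E ** transpose E = F ** transpose E"

text \<open>
  The two orders below are meant for dual matrices \<open>A\<close>, \<open>B\<close> whose DMPGIs exist;
  this domain condition is not part of the definitions and has to be assumed separately.
\<close>

definition dual_minus_le :: "dual_num^'n^'m \<Rightarrow> dual_num^'n^'m \<Rightarrow> bool" where
  "dual_minus_le A B \<longleftrightarrow> minus_le (std_matrix A) (std_matrix B) \<and> DMPGI_exists (B - A)"

definition dual_minus_star_le :: "dual_num^'n^'m \<Rightarrow> dual_num^'n^'m \<Rightarrow> bool" where
  "dual_minus_star_le A B \<longleftrightarrow> star_le (std_matrix A) (std_matrix B) \<and> DMPGI_exists (B - A)"

end

theory Submission
  imports Defs
begin

text \<open>
  If \<open>E\<close> is below \<open>F\<close> in the star order and \<open>G = F - E\<close>, then \<open>E\<^sup>T G = 0\<close> makes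
  the column spaces of \<open>E\<close> and \<open>G\<close> orthogonal. Since the column space of \<open>E\<close> is that of
  \<open>E E\<^sup>T = F E\<^sup>T\<close>, it lies in the column space of \<open>F\<close>, which is therefore the
  orthogonal sum of those of \<open>E\<close> and \<open>G\<close>; ranks add up.
\<close>

text \<open>Split \<open>x\<close> into \<open>transpose E *v z\<close>, in the row space of
  \<open>E\<close>, and a part orthogonal to that space. \<open>E\<close> kills the latter, so
  \<open>E *v x\<close> depends on \<open>z\<close> alone.\<close>

lemma range_matrix_mult_transpose:
  fixes E :: "real^'n^'m"
  shows "range ((*v) (E ** transpose E)) = range ((*v) E)"
proof
  show "range ((*v) (E ** transpose E)) \<subseteq> range ((*v) E)"
    by (auto simp flip: matrix_vector_mul_assoc)
  show "range ((*v) E) \<subseteq> range ((*v) (E ** transpose E))"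
  proof clarify
    fix x
    let ?R = "range ((*v) (transpose E))"
    obtain u v where u: "u \<in> span ?R" and v: "\<And>w. w \<in> span ?R \<Longrightarrow> orthogonal v w"
      and x: "x = u + v"
      using orthogonal_subspace_decomp_exists [of ?R x] by metis
    have "span ?R = ?R"
      unfolding span_eq_iff by (rule linear_subspace_image) simp_all
    with u obtain z where z: "u = transpose E *v z"
      by blast
    \<comment> \<open>Moving \<open>E\<close> across turns this inner product into the squared norm
      of \<open>E *v v\<close>.\<close>
    have "v \<bullet> (transpose E *v (E *v v)) = 0"
      using v[OF span_base] by (auto simp: orthogonal_def)
    then have "E *v v = 0"
      by (metis dot_lmul_matrix inner_eq_zero_iff inner_commute transpose_matrix_vector)
    then have "E *v x = (E ** transpose E) *v z"
      by (simp add: x z matrix_vector_right_distrib flip: matrix_vector_mul_assoc)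
    then show "E *v x \<in> range ((*v) (E ** transpose E))"
      by simp
  qed
qed

lemma star_le_imp_minus_le:
  fixes E F :: "real^'n^'m"
  assumes "star_le E F"
  shows "minus_le E F"
proof -
  define G where "G = F - E"
  let ?E = "range ((*v) E)" and ?F = "range ((*v) F)" and ?G = "range ((*v) G)"
  have EF: "transpose E ** E = transpose E ** F" "E ** transpose E = F ** transpose E"
    using assms by (auto simp: star_le_def)
  have F: "F *v x = E *v x + G *v x" for x
    by (simp add: G_def matrix_vector_mult_diff_rdistrib)
  have sub: "subspace ?E" "subspace ?F" "subspace ?G"
    by (simp_all add: linear_subspace_image)
  have "(E *v x) \<bullet> (G *v y) = 0" for x y
  proof -
    have "transpose E *v (G *v y) = 0"
      by (simp add: G_def EF(1) matrix_vector_mul_assoc matrix_vector_mult_diff_rdistrib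
          matrix_vector_mult_diff_distrib)
    then show ?thesis
      by (metis dot_lmul_matrix inner_zero_right matrix_transpose_mul transpose_matrix_vector
          transpose_transpose)
  qed
  then have orth: "orthogonal x y" if "x \<in> ?E" "y \<in> ?G" for x y
    using that by (auto simp: orthogonal_def)
  have E_sub: "?E \<subseteq> ?F"
    by (subst range_matrix_mult_transpose [symmetric])
       (auto simp: EF(2) simp flip: matrix_vector_mul_assoc)
  have "G *v x \<in> ?F" for x
  proof -
    have "G *v x = F *v x - E *v x"
      by (simp add: F)
    then show ?thesis
      using E_sub sub(2) by (metis rangeI subset_iff subspace_diff)
  qed
  then have "?F = {x + y | x y. x \<in> ?E \<and> y \<in> ?G}"
    using E_sub sub(2) by (auto simp: F intro!: subspace_add)
  \<comment> \<open>A common vector is orthogonal to itself.\<close>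
  moreover have "?E \<inter> ?G = {0}"
    using orth orthogonal_self subspace_0 [OF sub(1)] subspace_0 [OF sub(3)]
    by blast
  ultimately have "dim ?F = dim ?E + dim ?G"
    using dim_sums_Int [OF sub(1,3)] by simp
  then show ?thesis
    by (simp add: minus_le_def rank_dim_range G_def)
qed

theorem theorem5p3:
  fixes E E0 F F0 :: "real^'n^'m"
  assumes "DMPGI_exists (dual_matrix E E0)"
    and "DMPGI_exists (dual_matrix F F0)"
    and "dual_minus_star_le (dual_matrix E E0) (dual_matrix F F0)"
  shows "dual_minus_le (dual_matrix E E0) (dual_matrix F F0)"
  \<comment> \<open>Both orders demand the same DMPGI of the difference, so only the standard parts
    have to be compared.\<close>
  using assms(3) by (simp add: dual_minus_le_def dual_minus_star_le_def star_le_imp_minus_le)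

end
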